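(* For any integer $n \geq 2$, the friendship graph $F_n$ satisfies $\mathrm{Det}(F_n) = n$.
   Context: The friendship graph $F_n$ ($n \geq 2$) is the graph obtained by joining $n$ copies of the cycle graph $C_3$ at one common vertex. For a graph $G$ with vertex set $V(G)$, a subset $S \subseteq V(G)$ is a determining set for $G$ if whenever $g,h \in \mathrm{Aut}(G)$ satisfy $g(s) = h(s)$ for all $s \in S$, then $g = h$. The determining number $\mathrm{Det}(G)$ is the minimum cardinality of a determining set of $G$. *)

theory Defs
  imports "Graph_Theory.Pair_Digraph" "Graph_Theory.Digraph_Isomorphism"
    "HOL-Combinatorics.Permutations"
begin

text \<open>
  Undirected simple graphs are symmetric loop-free digraphs whose arcs are pairs of vertices
  (locale \<open>pair_graph\<close>): an edge \<open>{u, v}\<close> is the pair of arcs \<open>(u, v)\<close>, \<open>(v, u)\<close>.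
\<close>

(* The cycle graph only for n >= 3: n = 1 would give a loop. *)
definition cycle_graph :: "nat \<Rightarrow> nat pair_pre_digraph" where
  "cycle_graph n =
    \<lparr>pverts = {..<n},
     parcs = {(u, v). u < n \<and> v < n \<and> (v = (u + 1) mod n \<or> u = (v + 1) mod n)}\<rparr>"

(* Embeds the i-th copy of a graph into the joined graph: the vertex c of every copy becomes
   the common vertex None, and all other vertices stay distinct. *)
definition join_vertex :: "'a \<Rightarrow> nat \<Rightarrow> 'a \<Rightarrow> (nat \<times> 'a) option" where
  "join_vertex c i v = (if v = c then None else Some (i, v))"

definition join_copies :: "nat \<Rightarrow> 'a pair_pre_digraph \<Rightarrow> 'a \<Rightarrow> (nat \<times> 'a) option pair_pre_digraph" where
  "join_copies n G c =
    \<lparr>pverts = (\<Union>i<n. join_vertex c i ` pverts G),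
     parcs = (\<Union>i<n. map_prod (join_vertex c i) (join_vertex c i) ` parcs G)\<rparr>"

definition friendship_graph :: "nat \<Rightarrow> (nat \<times> nat) option pair_pre_digraph" where
  "friendship_graph n = join_copies n (cycle_graph 3) 0"

(* Using "permutes" fixes the values outside the vertex set to the identity, so that equality of
   automorphisms is equality of functions. *)
definition automorphisms :: "'a pair_pre_digraph \<Rightarrow> ('a \<Rightarrow> 'a) set" where
  "automorphisms G =
    {g. g permutes pverts G \<and>
        (\<forall>u\<in>pverts G. \<forall>v\<in>pverts G. (g u, g v) \<in> parcs G \<longleftrightarrow> (u, v) \<in> parcs G)}"

definition determining_set :: "'a pair_pre_digraph \<Rightarrow> 'a set \<Rightarrow> bool" where
  "determining_set G S \<longleftrightarrow>
    S \<subseteq> pverts G \<and>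
    (\<forall>g\<in>automorphisms G. \<forall>h\<in>automorphisms G. (\<forall>s\<in>S. g s = h s) \<longrightarrow> g = h)"

(* Meaningful when G has a finite determining set, in particular for finite G; "finite S" is
   there because card is 0 on infinite sets. *)
definition determining_number :: "'a pair_pre_digraph \<Rightarrow> nat" where
  "determining_number G = (LEAST k. \<exists>S. determining_set G S \<and> finite S \<and> card S = k)"

lemma cycle_graph_3:
  "pverts (cycle_graph 3) = {0, 1, 2}"
  "parcs (cycle_graph 3) = {(0, 1), (1, 2), (2, 0), (1, 0), (2, 1), (0, 2)}"
proof -
  have less: "u < 3 \<longleftrightarrow> u = 0 \<or> u = 1 \<or> u = 2" for u :: nat
    by auto
  show "pverts (cycle_graph 3) = {0, 1, 2}"
    by (auto simp: cycle_graph_def less)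
  show "parcs (cycle_graph 3) = {(0, 1), (1, 2), (2, 0), (1, 0), (2, 1), (0, 2)}"
    unfolding cycle_graph_def less by auto
qed

lemma friendship_graph_simps:
  "pverts (friendship_graph n) = (\<Union>i<n. {None, Some (i, 1), Some (i, 2)})"
  "parcs (friendship_graph n) =
    (\<Union>i<n. {(None, Some (i, 1)), (Some (i, 1), Some (i, 2)), (Some (i, 2), None),
             (Some (i, 1), None), (Some (i, 2), Some (i, 1)), (None, Some (i, 2))})"
  by (simp_all add: friendship_graph_def join_copies_def cycle_graph_3 join_vertex_def insert_commute)

lemma pair_graph_friendship_graph: "pair_graph (friendship_graph n)"
proof unfold_locales
  show "symmetric (friendship_graph n)"
    unfolding symmetric_def sym_def with_proj_simps friendship_graph_simps by blast
qed (auto simp: friendship_graph_simps)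

lemma card_pverts_friendship_graph:
  assumes "n \<ge> 1"
  shows "card (pverts (friendship_graph n)) = 2 * n + 1"
proof -
  have "0 < n" using assms by simp
  then have "pverts (friendship_graph n) = insert None (Some ` ({..<n} \<times> {1, 2}))"
    unfolding friendship_graph_simps by fast
  then show ?thesis
    by (simp add: card_image card_insert_if image_iff)
qed

text \<open>
  Automorphisms are the vertex parts of the isomorphisms from \<open>G\<close> to itself in the sense of
  \<open>digraph_isomorphism\<close>.
\<close>

lemma automorphisms_iff_digraph_isomorphism:
  assumes "pair_fin_digraph G"
  shows "g \<in> automorphisms G \<longleftrightarrow>
    g permutes pverts G \<and>
    (\<exists>f. pre_digraph.digraph_isomorphism (with_proj G) f \<and>
         app_iso f (with_proj G) = with_proj G \<and> iso_verts f = g)"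
    (is "_ \<longleftrightarrow> ?R")
proof -
  interpret pair_fin_digraph G by fact
  show ?thesis
  proof
    assume g: "g \<in> automorphisms G"
    then have perm: "g permutes pverts G" and
      pres: "\<And>u v. u \<in> pverts G \<Longrightarrow> v \<in> pverts G \<Longrightarrow> (g u, g v) \<in> parcs G \<longleftrightarrow> (u, v) \<in> parcs G"
      by (auto simp: automorphisms_def)
    let ?f = "\<lparr>iso_verts = g, iso_arcs = map_prod g g, iso_head = snd, iso_tail = fst\<rparr>"
    have inj: "inj g" using perm by (rule permutes_inj)
    have sub: "map_prod g g ` parcs G \<subseteq> parcs G"
    proof
      fix e assume "e \<in> map_prod g g ` parcs G"
      then obtain u v where uv: "(u, v) \<in> parcs G" "e = (g u, g v)" by auto
      then show "e \<in> parcs G" using pres[OF in_arcsD1[OF uv(1)] in_arcsD2[OF uv(1)]] by simp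
    qed
    have "map_prod g g ` parcs G = parcs G"
      by (rule endo_inj_surj[OF pair_finite_arcs sub])
        (rule inj_on_subset[OF prod.inj_map[OF inj inj] subset_UNIV])
    then have "app_iso ?f (with_proj G) = with_proj G"
      by (simp add: app_iso_def with_proj_def permutes_image[OF perm])
    moreover have "pre_digraph.digraph_isomorphism (with_proj G) ?f"
      unfolding pre_digraph.digraph_isomorphism_def
      using wf_digraph inj_on_subset[OF prod.inj_map[OF inj inj] subset_UNIV, of "parcs G"]
        inj_on_subset[OF inj subset_UNIV, of "pverts G"]
      by simp
    ultimately show ?R
      using perm by (metis digraph_isomorphism.select_convs(1))
  next
    assume ?R
    then obtain f where perm: "g permutes pverts G"
      and iso: "pre_digraph.digraph_isomorphism (with_proj G) f"
      and eq: "app_iso f (with_proj G) = with_proj G" and f: "iso_verts f = g"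
      by blast
    have arcs: "iso_arcs f ` parcs G = parcs G"
      using arg_cong[OF eq, of arcs] by simp
    have proj: "iso_tail f = fst" "iso_head f = snd"
      using arg_cong[OF eq, of tail] arg_cong[OF eq, of head] by simp_all
    have ends: "iso_arcs f (u, v) = (g u, g v)" if uv: "(u, v) \<in> parcs G" for u v
    proof -
      have "g u = fst (iso_arcs f (u, v)) \<and> g v = snd (iso_arcs f (u, v))"
        using iso uv
        unfolding pre_digraph.digraph_isomorphism_def with_proj_simps proj f by force
      then show ?thesis by (metis prod.collapse)
    qed
    have "(g u, g v) \<in> parcs G \<longleftrightarrow> (u, v) \<in> parcs G" for u v
    proof
      assume "(g u, g v) \<in> parcs G"
      then have "(g u, g v) \<in> iso_arcs f ` parcs G" by (simp only: arcs)
      then obtain a b where ab: "(a, b) \<in> parcs G" "(g u, g v) = iso_arcs f (a, b)"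
        by (metis imageE surj_pair)
      have "g u = g a" "g v = g b" using ab(2) unfolding ends[OF ab(1)] by simp_all
      then have "u = a" "v = b" using permutes_inj[OF perm] by (simp_all add: inj_eq)
      then show "(u, v) \<in> parcs G" using ab(1) by simp
    next
      assume uv: "(u, v) \<in> parcs G"
      then have "iso_arcs f (u, v) \<in> iso_arcs f ` parcs G" by (rule imageI)
      then show "(g u, g v) \<in> parcs G" by (simp only: arcs ends[OF uv])
    qed
    with perm show "g \<in> automorphisms G"
      unfolding automorphisms_def by blast
  qed
qed

end

theory Submission
  imports Defs
begin

text \<open>
  The two outer vertices of a triangle of \<open>F\<^sub>n\<close> are twins: they have the same neighbours
  apart from each other, so exchanging them is an automorphism. A determining set therefore
  contains at least one of them for every triangle (\<open>determining_set_meets_twins\<close>), hence at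
  least \<open>n\<close> vertices.

  Conversely, choosing one outer vertex from each triangle suffices. The reason is the property
  that gives friendship graphs their name: two distinct vertices have exactly one common
  neighbour. Automorphisms that agree on two vertices thus agree on the common neighbour of
  these two (\<open>automorphisms_agree_on_common_neighbour\<close>). For \<open>n \<ge> 2\<close> the centre is the common
  neighbour of two chosen vertices, and the remaining vertex of a triangle is the common
  neighbour of the centre and the chosen vertex of that triangle. So agreement spreads from the
  chosen vertices to the whole graph.
\<close>

lemma transpose_twins_automorphism:
  assumes "u \<in> pverts G" "v \<in> pverts G"
    and twins: "\<And>w. w \<noteq> u \<Longrightarrow> w \<noteq> v \<Longrightarrow>
      ((u, w) \<in> parcs G \<longleftrightarrow> (v, w) \<in> parcs G) \<and> ((w, u) \<in> parcs G \<longleftrightarrow> (w, v) \<in> parcs G)"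
    and "(u, v) \<in> parcs G \<longleftrightarrow> (v, u) \<in> parcs G"
    and "(u, u) \<in> parcs G \<longleftrightarrow> (v, v) \<in> parcs G"
  shows "transpose u v \<in> automorphisms G"
proof -
  have "(transpose u v x, transpose u v y) \<in> parcs G \<longleftrightarrow> (x, y) \<in> parcs G" for x y
  proof -
    have trichotomy: thesis
      if "z = u \<Longrightarrow> thesis" "z = v \<Longrightarrow> thesis" "\<lbrakk>z \<noteq> u; z \<noteq> v\<rbrakk> \<Longrightarrow> thesis"
      for z thesis
      using that by blast
    show ?thesis
      by (rule trichotomy[of x]; rule trichotomy[of y]) (simp_all add: twins assms(4,5))
  qed
  then show ?thesis
    using assms(1,2) by (simp add: automorphisms_def permutes_swap_id)
qed

text \<open>
  A set that misses both twins cannot tell their exchange from the identity.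
\<close>

lemma determining_set_meets_twins:
  assumes "determining_set G S" and "u \<noteq> v" and swap: "transpose u v \<in> automorphisms G"
  shows "u \<in> S \<or> v \<in> S"
proof (rule ccontr)
  assume "\<not> (u \<in> S \<or> v \<in> S)"
  then have "\<forall>s\<in>S. transpose u v s = id s"
    by (metis id_apply transpose_apply_other)
  moreover have "id \<in> automorphisms G"
    by (simp add: automorphisms_def permutes_id)
  ultimately have "transpose u v = id"
    using assms(1) swap unfolding determining_set_def by blast
  then have "transpose u v u = u" by simp
  then show False using \<open>u \<noteq> v\<close> by simp
qed

text \<open>
  The images of \<open>w\<close> are both common neighbours of the two distinct vertices \<open>g u = h u\<close> and
  \<open>g v = h v\<close>.
\<close>

lemma automorphisms_agree_on_common_neighbour:
  assumes unique: "\<And>a b x y. \<lbrakk>a \<noteq> b; (a, x) \<in> parcs G; (b, x) \<in> parcs G;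
      (a, y) \<in> parcs G; (b, y) \<in> parcs G\<rbrakk> \<Longrightarrow> x = y"
    and g: "g \<in> automorphisms G" and h: "h \<in> automorphisms G"
    and verts: "u \<in> pverts G" "v \<in> pverts G" "w \<in> pverts G"
    and "u \<noteq> v" and arcs: "(u, w) \<in> parcs G" "(v, w) \<in> parcs G"
    and agree: "g u = h u" "g v = h v"
  shows "g w = h w"
proof -
  have "inj g" using g by (auto simp: automorphisms_def permutes_inj)
  then have "g u \<noteq> g v" using \<open>u \<noteq> v\<close> by (simp add: inj_eq)
  moreover have "(g u, g w) \<in> parcs G" "(g v, g w) \<in> parcs G"
    using g verts arcs by (auto simp: automorphisms_def)
  moreover have "(g u, h w) \<in> parcs G" "(g v, h w) \<in> parcs G"
    unfolding agree using h verts arcs by (auto simp: automorphisms_def)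
  ultimately show ?thesis by (rule unique)
qed

lemma friendship_graph_vertex_iff:
  "None \<in> pverts (friendship_graph n) \<longleftrightarrow> 0 < n"
  "Some (i, j) \<in> pverts (friendship_graph n) \<longleftrightarrow> i < n \<and> (j = 1 \<or> j = 2)"
  unfolding friendship_graph_simps by auto

lemma friendship_graph_arc_iff:
  "(None, None) \<notin> parcs (friendship_graph n)"
  "(None, Some (i, j)) \<in> parcs (friendship_graph n) \<longleftrightarrow> i < n \<and> (j = 1 \<or> j = 2)"
  "(Some (i, j), None) \<in> parcs (friendship_graph n) \<longleftrightarrow> i < n \<and> (j = 1 \<or> j = 2)"
  "(Some (i, j), Some (k, l)) \<in> parcs (friendship_graph n) \<longleftrightarrow>
    i < n \<and> k = i \<and> (j = 1 \<and> l = 2 \<or> j = 2 \<and> l = 1)"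
  unfolding friendship_graph_simps by auto

text \<open>
  The only common neighbour of two outer vertices is the centre, and the only common neighbour
  of the centre and an outer vertex is the twin of the latter.
\<close>

lemma friendship_graph_common_neighbour_unique:
  assumes "a \<noteq> b" "(a, x) \<in> parcs (friendship_graph n)" "(b, x) \<in> parcs (friendship_graph n)"
    "(a, y) \<in> parcs (friendship_graph n)" "(b, y) \<in> parcs (friendship_graph n)"
  shows "x = y"
proof -
  have centre_outer: "z = w"
    if "(None, z) \<in> parcs (friendship_graph n)" "(None, w) \<in> parcs (friendship_graph n)"
      "(Some p, z) \<in> parcs (friendship_graph n)" "(Some p, w) \<in> parcs (friendship_graph n)"
    for z w p
    using that by (cases p; cases z; cases w) (auto simp: friendship_graph_arc_iff)
  have outer_outer: "z = None"
    if "p \<noteq> q" "(Some p, z) \<in> parcs (friendship_graph n)" "(Some q, z) \<in> parcs (friendship_graph n)"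
    for z p q
    using that by (cases p; cases q; cases z) (auto simp: friendship_graph_arc_iff)
  show ?thesis
  proof (cases a)
    case None
    then obtain q where "b = Some q" using \<open>a \<noteq> b\<close> by (cases b) auto
    then show ?thesis using None assms centre_outer by simp
  next
    case (Some p)
    show ?thesis
    proof (cases b)
      case None
      then show ?thesis using Some assms centre_outer by simp
    next
      case (Some q)
      then have "p \<noteq> q" using \<open>a = Some p\<close> \<open>a \<noteq> b\<close> by simp
      then show ?thesis
        using Some \<open>a = Some p\<close> assms outer_outer[of p q x] outer_outer[of p q y] by simp
    qed
  qed
qed

lemma friendship_graph_transpose_automorphism:
  assumes "i < n"
  shows "transpose (Some (i, 1)) (Some (i, 2)) \<in> automorphisms (friendship_graph n)"
proof (rule transpose_twins_automorphism)
  let ?F = "friendship_graph n"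
  fix w :: "(nat \<times> nat) option"
  assume "w \<noteq> Some (i, 1)" "w \<noteq> Some (i, 2)"
  then show "((Some (i, 1), w) \<in> parcs ?F \<longleftrightarrow> (Some (i, 2), w) \<in> parcs ?F) \<and>
      ((w, Some (i, 1)) \<in> parcs ?F \<longleftrightarrow> (w, Some (i, 2)) \<in> parcs ?F)"
    by (cases w) (auto simp: friendship_graph_arc_iff)
qed (use assms in \<open>auto simp: friendship_graph_vertex_iff friendship_graph_arc_iff\<close>)

lemma friendship_graph_determining_set_card_ge:
  assumes "determining_set (friendship_graph n) S" "finite S"
  shows "n \<le> card S"
proof -
  \<comment> \<open>\<open>fst \<circ> the\<close> sends an outer vertex to the index of its triangle; if the centre lies in \<open>S\<close>, its
    unspecified image only enlarges the set on the right.\<close>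
  have "{..<n} \<subseteq> (fst \<circ> the) ` S"
  proof
    fix i assume "i \<in> {..<n}"
    then have "Some (i, 1) \<in> S \<or> Some (i, 2) \<in> S"
      by (intro determining_set_meets_twins[OF assms(1)] friendship_graph_transpose_automorphism)
        auto
    then show "i \<in> (fst \<circ> the) ` S" by force
  qed
  then have "card {..<n} \<le> card S"
    by (rule surj_card_le[OF assms(2)])
  then show ?thesis by simp
qed

lemma friendship_graph_outer_vertices_determining:
  assumes "n \<ge> 2"
  shows "determining_set (friendship_graph n) ((\<lambda>i. Some (i, 1)) ` {..<n})"
  unfolding determining_set_def
proof (intro conjI ballI impI)
  let ?F = "friendship_graph n"
  show "(\<lambda>i. Some (i, 1)) ` {..<n} \<subseteq> pverts ?F"
    by (auto simp: friendship_graph_simps)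
  fix g h
  assume g: "g \<in> automorphisms ?F" and h: "h \<in> automorphisms ?F"
    and "\<forall>s\<in>(\<lambda>i. Some (i, 1)) ` {..<n}. g s = h s"
  then have outer: "g (Some (i, 1)) = h (Some (i, 1))" if "i < n" for i
    using that by simp
  have spread: "g w = h w"
    if "u \<in> pverts ?F" "v \<in> pverts ?F" "w \<in> pverts ?F" "u \<noteq> v"
      "(u, w) \<in> parcs ?F" "(v, w) \<in> parcs ?F" "g u = h u" "g v = h v" for u v w
    by (rule automorphisms_agree_on_common_neighbour[OF _ g h that])
      (rule friendship_graph_common_neighbour_unique)
  have centre: "g None = h None"
    by (rule spread[where u = "Some (0, 1)" and v = "Some (1, 1)"])
      (use assms outer in \<open>auto simp: friendship_graph_vertex_iff friendship_graph_arc_iff\<close>)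
  have partner: "g (Some (i, 2)) = h (Some (i, 2))" if "i < n" for i
    by (rule spread[where u = None and v = "Some (i, 1)"])
      (use that outer centre in \<open>auto simp: friendship_graph_vertex_iff friendship_graph_arc_iff\<close>)
  show "g = h"
  proof
    fix v
    show "g v = h v"
    proof (cases "v \<in> pverts ?F")
      case True
      then show ?thesis
        using outer centre partner
        by (cases v) (auto simp: friendship_graph_vertex_iff)
    next
      case False
      then show ?thesis
        using g h by (auto simp: automorphisms_def permutes_not_in)
    qed
  qed
qed

theorem theorem2p11:
  fixes n :: nat
  assumes "n \<ge> 2"
  shows "determining_number (friendship_graph n) = n"
  unfolding determining_number_def
proof (rule Least_equality)
  have "card ((\<lambda>i::nat. Some (i, 1::nat)) ` {..<n}) = n"
    by (simp add: card_image inj_on_def)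
  then show "\<exists>S. determining_set (friendship_graph n) S \<and> finite S \<and> card S = n"
    using friendship_graph_outer_vertices_determining[OF assms] by blast
qed (use friendship_graph_determining_set_card_ge in blast)

end
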